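(* Let $(X,\Sigma,\mu)$ be a measure space, let $1\le p<\infty$, and let $\mathcal F\subseteq\Lambda^p(X)$. Then $\mathcal F$ is totally bounded in $\Lambda^p(X)$ if and only if the following two conditions hold: (i) for every fixed $M>0$, the truncated family $T_M(\mathcal F):=\{T_Mf: f\in\mathcal F\}$ is totally bounded in $L^p(X)$; (ii) the family $\mathcal F$ is uniformly approximable by truncations, that is, $$\lim_{M\to\infty}\ \sup_{f\in\mathcal F}\ \|\min(|f-T_Mf|,1)\|_p=0.$$
   Context: For a measure space $(X,\Sigma,\mu)$ (arbitrary, no finiteness assumed) and $1\le p<\infty$, $\Lambda^p(X)$ is the set of measurable functions $f:X\to\mathbb R$ with $\int_X\min(|f|,1)^p\,\mathrm d\mu<\infty$, where functions agreeing almost everywhere are identified. It is a vector space, equipped with the translation-invariant metric $(f,g)\mapsto\|\min(|f-g|,1)\|_p$, where $\|\cdot\|_p$ is the norm of the Lebesgue space $L^p(X)$. Total boundedness in $\Lambda^p(X)$ is with respect to this metric; total boundedness in $L^p(X)$ is with respect to the norm $\|\cdot\|_p$. For $M>0$, $T_M(a):=\max\{-M,\min\{a,M\}\}$ for $a\in\mathbb R$, and $T_Mf:=T_M\circ f$. For $f\in\Lambda^p(X)$ one has $T_Mf\in L^p(X)$. *)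

theory Defs
  imports "HOL-Analysis.Analysis"
begin

definition ae_rel :: "'a measure \<Rightarrow> (('a \<Rightarrow> real) \<times> ('a \<Rightarrow> real)) set" where
  "ae_rel M = {(f, g). f \<in> borel_measurable M \<and> g \<in> borel_measurable M \<and> (AE x in M. f x = g x)}"

definition ae_class :: "'a measure \<Rightarrow> ('a \<Rightarrow> real) \<Rightarrow> ('a \<Rightarrow> real) set" where
  "ae_class M f = ae_rel M `` {f}"

definition ae_rep :: "('a \<Rightarrow> real) set \<Rightarrow> 'a \<Rightarrow> real" where
  "ae_rep u = (SOME f. f \<in> u)"

text \<open>Pitfall: the Bochner integral of a non-integrable function is 0, so \<open>lp_norm\<close> is only meaningful if
  \<open>\<bar>f\<bar> powr p\<close> is integrable. Below it is applied to differences of elements of \<open>Lp_space\<close> and to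
  functions \<open>min \<bar>f - g\<bar> 1\<close> with \<open>f\<close>, \<open>g\<close> from \<open>Lambda_space\<close>, where this is the case.\<close>

definition lp_norm :: "'a measure \<Rightarrow> real \<Rightarrow> ('a \<Rightarrow> real) \<Rightarrow> real" where
  "lp_norm M p f = (\<integral>x. \<bar>f x\<bar> powr p \<partial>M) powr (1 / p)"

definition Lp_space :: "'a measure \<Rightarrow> real \<Rightarrow> ('a \<Rightarrow> real) set set" where
  "Lp_space M p =
     {f \<in> borel_measurable M. (\<integral>\<^sup>+x. ennreal (\<bar>f x\<bar> powr p) \<partial>M) < \<infinity>} // ae_rel M"

definition Lp_dist :: "'a measure \<Rightarrow> real \<Rightarrow> ('a \<Rightarrow> real) set \<Rightarrow> ('a \<Rightarrow> real) set \<Rightarrow> real" where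
  "Lp_dist M p u v = lp_norm M p (\<lambda>x. ae_rep u x - ae_rep v x)"

definition Lambda_space :: "'a measure \<Rightarrow> real \<Rightarrow> ('a \<Rightarrow> real) set set" where
  "Lambda_space M p =
     {f \<in> borel_measurable M. (\<integral>\<^sup>+x. ennreal (min \<bar>f x\<bar> 1 powr p) \<partial>M) < \<infinity>} // ae_rel M"

definition Lambda_dist :: "'a measure \<Rightarrow> real \<Rightarrow> ('a \<Rightarrow> real) set \<Rightarrow> ('a \<Rightarrow> real) set \<Rightarrow> real" where
  "Lambda_dist M p u v = lp_norm M p (\<lambda>x. min \<bar>ae_rep u x - ae_rep v x\<bar> 1)"

definition trunc :: "real \<Rightarrow> real \<Rightarrow> real" where
  "trunc c a = max (- c) (min a c)"

definition trunc_class :: "'a measure \<Rightarrow> real \<Rightarrow> ('a \<Rightarrow> real) set \<Rightarrow> ('a \<Rightarrow> real) set" where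
  "trunc_class M c u = ae_class M (trunc c \<circ> ae_rep u)"


subsection \<open>Independence of representatives\<close>

lemma equiv_ae_rel: "equiv (borel_measurable M) (ae_rel M)"
  by (rule equivI) (auto simp: ae_rel_def refl_on_def sym_def trans_def)

lemma mem_ae_class:
  "f \<in> borel_measurable M \<Longrightarrow>
    g \<in> ae_class M f \<longleftrightarrow> g \<in> borel_measurable M \<and> (AE x in M. f x = g x)"
  by (auto simp: ae_class_def ae_rel_def)

lemma ae_class_eq_iff:
  assumes "f \<in> borel_measurable M" "g \<in> borel_measurable M"
  shows "ae_class M f = ae_class M g \<longleftrightarrow> (AE x in M. f x = g x)"
  using eq_equiv_class_iff[OF equiv_ae_rel, of f M g] assms
  by (auto simp: ae_class_def ae_rel_def)

lemma ae_rep_class: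
  assumes "f \<in> borel_measurable M"
  shows "ae_rep (ae_class M f) \<in> borel_measurable M" "AE x in M. f x = ae_rep (ae_class M f) x"
proof -
  have "f \<in> ae_class M f" using assms by (simp add: mem_ae_class)
  then have "ae_rep (ae_class M f) \<in> ae_class M f" unfolding ae_rep_def by (rule someI[where P = "\<lambda>h. h \<in> ae_class M f"])
  then show "ae_rep (ae_class M f) \<in> borel_measurable M" "AE x in M. f x = ae_rep (ae_class M f) x"
    using assms by (auto simp: mem_ae_class)
qed

lemma measurable_trunc [measurable]: "trunc c \<in> borel_measurable borel"
  unfolding trunc_def[abs_def] by measurable

lemma lp_norm_cong_AE:
  assumes [measurable]: "f \<in> borel_measurable M" "g \<in> borel_measurable M"
    and "AE x in M. f x = g x"
  shows "lp_norm M p f = lp_norm M p g"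
proof -
  have "(\<integral>x. \<bar>f x\<bar> powr p \<partial>M) = (\<integral>x. \<bar>g x\<bar> powr p \<partial>M)"
    using assms(3) by (intro integral_cong_AE) auto
  then show ?thesis by (simp add: lp_norm_def)
qed

lemma Lp_dist_class:
  assumes [measurable]: "f \<in> borel_measurable M" "g \<in> borel_measurable M"
  shows "Lp_dist M p (ae_class M f) (ae_class M g) = lp_norm M p (\<lambda>x. f x - g x)"
proof -
  note [measurable] = ae_rep_class(1)[OF assms(1)] ae_rep_class(1)[OF assms(2)]
  show ?thesis unfolding Lp_dist_def
    by (rule lp_norm_cong_AE)
      (use ae_rep_class(2)[OF assms(1)] ae_rep_class(2)[OF assms(2)] in auto)
qed

lemma Lambda_dist_class:
  assumes [measurable]: "f \<in> borel_measurable M" "g \<in> borel_measurable M"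
  shows "Lambda_dist M p (ae_class M f) (ae_class M g) = lp_norm M p (\<lambda>x. min \<bar>f x - g x\<bar> 1)"
proof -
  note [measurable] = ae_rep_class(1)[OF assms(1)] ae_rep_class(1)[OF assms(2)]
  show ?thesis unfolding Lambda_dist_def
    by (rule lp_norm_cong_AE)
      (use ae_rep_class(2)[OF assms(1)] ae_rep_class(2)[OF assms(2)] in auto)
qed

lemma trunc_class_class:
  assumes [measurable]: "f \<in> borel_measurable M"
  shows "trunc_class M c (ae_class M f) = ae_class M (trunc c \<circ> f)"
proof -
  note [measurable] = ae_rep_class(1)[OF assms(1)]
  show ?thesis unfolding trunc_class_def
    using ae_rep_class(2)[OF assms(1)] by (subst ae_class_eq_iff) (auto simp: comp_def)
qed

definition p_integrable :: "'a measure \<Rightarrow> real \<Rightarrow> ('a \<Rightarrow> real) \<Rightarrow> bool" where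
  "p_integrable M p f \<longleftrightarrow> f \<in> borel_measurable M \<and> integrable M (\<lambda>x. \<bar>f x\<bar> powr p)"

lemma p_integrable_iff:
  "p_integrable M p f \<longleftrightarrow>
    f \<in> borel_measurable M \<and> (\<integral>\<^sup>+x. ennreal (\<bar>f x\<bar> powr p) \<partial>M) < \<infinity>"
  unfolding p_integrable_def by (auto simp: integrable_iff_bounded)

lemma Lp_space_iff: "u \<in> Lp_space M p \<longleftrightarrow> (\<exists>f. p_integrable M p f \<and> u = ae_class M f)"
  by (auto simp: Lp_space_def quotient_def p_integrable_iff ae_class_def)

lemma Lambda_space_iff:
  "u \<in> Lambda_space M p \<longleftrightarrow>
    (\<exists>f \<in> borel_measurable M. p_integrable M p (\<lambda>x. min \<bar>f x\<bar> 1) \<and> u = ae_class M f)"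
  by (auto simp: Lambda_space_def quotient_def p_integrable_iff ae_class_def)


subsection \<open>The two metric spaces\<close>

lemma powr_convex_nonneg:
  fixes u v t p :: real
  assumes "p \<ge> 1" "u \<ge> 0" "v \<ge> 0" "0 \<le> t" "t \<le> 1"
  shows "(t * u + (1 - t) * v) powr p \<le> t * u powr p + (1 - t) * v powr p"
proof -
  have *: "(s * w) powr p \<le> s * w powr p" if "0 \<le> s" "s \<le> 1" "w \<ge> 0" for s w :: real
  proof -
    have "s powr p \<le> s"
      using powr_mono'[of 1 p s] that assms(1) by (cases "s = 0") auto
    then show ?thesis using that by (simp add: powr_mult mult_right_mono)
  qed
  consider "u = 0" | "v = 0" | "u > 0" "v > 0" using assms by linarith
  then show ?thesis
  proof cases
    case 3
    then show ?thesis
      using convex_onD[OF powr_convex[OF assms(1)], of "1 - t" u v] assms by simp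
  qed (use * assms in auto)
qed

lemma p_integrable_mono:
  assumes "p \<ge> 1" "p_integrable M p g" and [measurable]: "f \<in> borel_measurable M"
    and "\<And>x. \<bar>f x\<bar> \<le> \<bar>g x\<bar>"
  shows "p_integrable M p f" "lp_norm M p f \<le> lp_norm M p g"
proof -
  have le: "\<bar>f x\<bar> powr p \<le> \<bar>g x\<bar> powr p" for x
    using assms(1,4) by (intro powr_mono2) auto
  have g: "integrable M (\<lambda>x. \<bar>g x\<bar> powr p)" using assms(2) by (simp add: p_integrable_def)
  have f: "integrable M (\<lambda>x. \<bar>f x\<bar> powr p)"
    by (rule Bochner_Integration.integrable_bound[OF g]) (use le in auto)
  then show "p_integrable M p f" by (simp add: p_integrable_def)
  have "(\<integral>x. \<bar>f x\<bar> powr p \<partial>M) \<le> (\<integral>x. \<bar>g x\<bar> powr p \<partial>M)"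
    by (rule integral_mono[OF f g le])
  then show "lp_norm M p f \<le> lp_norm M p g"
    unfolding lp_norm_def using assms(1) by (intro powr_mono2) auto
qed

lemma lp_norm_nonneg: "lp_norm M p f \<ge> 0"
  by (simp add: lp_norm_def)

lemma lp_norm_powr:
  assumes "p \<ge> 1" shows "lp_norm M p f powr p = (\<integral>x. \<bar>f x\<bar> powr p \<partial>M)"
  using assms by (simp add: lp_norm_def powr_powr)

lemma lp_norm_eq_0_iff:
  assumes "p \<ge> 1" "p_integrable M p f"
  shows "lp_norm M p f = 0 \<longleftrightarrow> (AE x in M. f x = 0)"
proof -
  have "lp_norm M p f = 0 \<longleftrightarrow> (\<integral>x. \<bar>f x\<bar> powr p \<partial>M) = 0"
    using assms(1) by (simp add: lp_norm_def)
  also have "\<dots> \<longleftrightarrow> (AE x in M. \<bar>f x\<bar> powr p = 0)"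
    using assms(2) by (intro integral_nonneg_eq_0_iff_AE) (auto simp: p_integrable_def)
  also have "\<dots> \<longleftrightarrow> (AE x in M. f x = 0)" by simp
  finally show ?thesis .
qed

lemma p_integrable_add:
  assumes "p \<ge> 1" "p_integrable M p f" "p_integrable M p g"
  shows "p_integrable M p (\<lambda>x. f x + g x)"
proof -
  have [measurable]: "f \<in> borel_measurable M" "g \<in> borel_measurable M"
    using assms by (auto simp: p_integrable_def)
  have *: "\<bar>f x + g x\<bar> powr p \<le> 2 powr p * (\<bar>f x\<bar> powr p + \<bar>g x\<bar> powr p)" for x
  proof -
    have "\<bar>f x + g x\<bar> powr p \<le> (2 * (1/2 * \<bar>f x\<bar> + (1 - 1/2) * \<bar>g x\<bar>)) powr p"
      using assms(1) by (intro powr_mono2) auto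
    also have "\<dots> = 2 powr p * (1/2 * \<bar>f x\<bar> + (1 - 1/2) * \<bar>g x\<bar>) powr p"
      by (subst powr_mult) auto
    also have "\<dots> \<le> 2 powr p * (1/2 * \<bar>f x\<bar> powr p + (1 - 1/2) * \<bar>g x\<bar> powr p)"
      using powr_convex_nonneg[OF assms(1), of "\<bar>f x\<bar>" "\<bar>g x\<bar>" "1/2"]
      by (intro mult_left_mono) auto
    also have "\<dots> \<le> 2 powr p * (\<bar>f x\<bar> powr p + \<bar>g x\<bar> powr p)"
    proof (rule mult_left_mono)
      show "1/2 * \<bar>f x\<bar> powr p + (1 - 1/2) * \<bar>g x\<bar> powr p \<le> \<bar>f x\<bar> powr p + \<bar>g x\<bar> powr p"
        using powr_ge_zero[of "\<bar>f x\<bar>" p] powr_ge_zero[of "\<bar>g x\<bar>" p] by (simp add: field_simps)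
    qed simp
    finally show ?thesis .
  qed
  have "integrable M (\<lambda>x. 2 powr p * (\<bar>f x\<bar> powr p + \<bar>g x\<bar> powr p))"
    using assms by (auto simp: p_integrable_def)
  then have "integrable M (\<lambda>x. \<bar>f x + g x\<bar> powr p)"
    by (rule Bochner_Integration.integrable_bound) (use * in auto)
  then show ?thesis by (simp add: p_integrable_def)
qed

lemma p_integrable_uminus: "p_integrable M p f \<Longrightarrow> p_integrable M p (\<lambda>x. - f x)"
  by (simp add: p_integrable_def)

lemma p_integrable_diff:
  assumes "p \<ge> 1" "p_integrable M p f" "p_integrable M p g"
  shows "p_integrable M p (\<lambda>x. f x - g x)"
  using p_integrable_add[OF assms(1,2) p_integrable_uminus[OF assms(3)]] by simp

lemma lp_norm_triangle:
  assumes p: "p \<ge> 1" and f: "p_integrable M p f" and g: "p_integrable M p g"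
  shows "lp_norm M p (\<lambda>x. f x + g x) \<le> lp_norm M p f + lp_norm M p g"
proof -
  have [measurable]: "f \<in> borel_measurable M" "g \<in> borel_measurable M"
    using f g by (auto simp: p_integrable_def)
  define A where "A = lp_norm M p f"
  define B where "B = lp_norm M p g"
  have AB: "A \<ge> 0" "B \<ge> 0" by (auto simp: A_def B_def lp_norm_nonneg)
  consider "A = 0" | "B = 0" | "A > 0" "B > 0" using AB by linarith
  then show ?thesis
  proof cases
    case 1
    then have "AE x in M. f x = 0" using lp_norm_eq_0_iff[OF p f] by (simp add: A_def)
    then have "lp_norm M p (\<lambda>x. f x + g x) = lp_norm M p g"
      by (intro lp_norm_cong_AE) auto
    then show ?thesis by (simp add: lp_norm_nonneg)
  next
    case 2
    then have "AE x in M. g x = 0" using lp_norm_eq_0_iff[OF p g] by (simp add: B_def)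
    then have "lp_norm M p (\<lambda>x. f x + g x) = lp_norm M p f"
      by (intro lp_norm_cong_AE) auto
    then show ?thesis by (simp add: lp_norm_nonneg)
  next
    case 3
    define t where "t = A / (A + B)"
    have t: "0 \<le> t" "t \<le> 1" "1 - t = B / (A + B)" using 3 by (auto simp: t_def field_simps)
    let ?h = "\<lambda>x. (A + B) powr p * (t * (\<bar>f x\<bar> powr p / A powr p) + (1 - t) * (\<bar>g x\<bar> powr p / B powr p))"
    have le: "\<bar>f x + g x\<bar> powr p \<le> ?h x" for x
    proof -
      have eq: "t * (\<bar>f x\<bar> / A) + (1 - t) * (\<bar>g x\<bar> / B) = (\<bar>f x\<bar> + \<bar>g x\<bar>) / (A + B)"
        unfolding t(3) using 3 by (simp add: t_def add_divide_distrib)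
      have "\<bar>f x + g x\<bar> powr p \<le> ((A + B) * (t * (\<bar>f x\<bar> / A) + (1 - t) * (\<bar>g x\<bar> / B))) powr p"
        unfolding eq using 3 p by (intro powr_mono2) auto
      also have "\<dots> = (A + B) powr p * (t * (\<bar>f x\<bar> / A) + (1 - t) * (\<bar>g x\<bar> / B)) powr p"
        using 3 t by (subst powr_mult) auto
      also have "\<dots> \<le> (A + B) powr p * (t * (\<bar>f x\<bar> / A) powr p + (1 - t) * (\<bar>g x\<bar> / B) powr p)"
        using 3 t p by (intro mult_left_mono powr_convex_nonneg) auto
      also have "\<dots> = ?h x" using 3 by (simp add: powr_divide)
      finally show ?thesis .
    qed
    have If: "integrable M (\<lambda>x. \<bar>f x\<bar> powr p)" and Ig: "integrable M (\<lambda>x. \<bar>g x\<bar> powr p)"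
      and Ifg: "integrable M (\<lambda>x. \<bar>f x + g x\<bar> powr p)"
      using f g p_integrable_add[OF p f g] by (auto simp: p_integrable_def)
    have "(\<integral>x. \<bar>f x + g x\<bar> powr p \<partial>M) \<le> (\<integral>x. ?h x \<partial>M)"
      using If Ig by (intro integral_mono[OF Ifg _ le]) auto
    also have "\<dots> = (A + B) powr p * (t * ((\<integral>x. \<bar>f x\<bar> powr p \<partial>M) / A powr p) +
        (1 - t) * ((\<integral>x. \<bar>g x\<bar> powr p \<partial>M) / B powr p))"
      using If Ig by simp
    also have "\<dots> = (A + B) powr p"
      using 3 by (simp add: A_def B_def lp_norm_powr[OF p, symmetric])
    finally have "(\<integral>x. \<bar>f x + g x\<bar> powr p \<partial>M) powr (1/p) \<le> ((A + B) powr p) powr (1/p)"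
      using p by (intro powr_mono2) auto
    also have "\<dots> = A + B" using 3 p by (simp add: powr_powr)
    finally show ?thesis by (simp add: lp_norm_def A_def B_def)
  qed
qed

lemma lp_norm_commute: "lp_norm M p (\<lambda>x. f x - g x) = lp_norm M p (\<lambda>x. g x - f x)"
  by (simp add: lp_norm_def abs_minus_commute)

theorem Metric_space_Lp:
  assumes p: "p \<ge> 1"
  shows "Metric_space (Lp_space M p) (Lp_dist M p)"
proof
  show "0 \<le> Lp_dist M p u v" for u v by (simp add: Lp_dist_def lp_norm_nonneg)
  show "Lp_dist M p u v = Lp_dist M p v u" for u v
    unfolding Lp_dist_def by (rule lp_norm_commute)
  fix u v assume "u \<in> Lp_space M p" "v \<in> Lp_space M p"
  then obtain f g where f: "p_integrable M p f" "u = ae_class M f"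
    and g: "p_integrable M p g" "v = ae_class M g" by (auto simp: Lp_space_iff)
  have m: "f \<in> borel_measurable M" "g \<in> borel_measurable M"
    using f g by (auto simp: p_integrable_def)
  show "Lp_dist M p u v = 0 \<longleftrightarrow> u = v"
    unfolding f(2) g(2) Lp_dist_class[OF m] ae_class_eq_iff[OF m]
    by (subst lp_norm_eq_0_iff[OF p p_integrable_diff[OF p f(1) g(1)]]) simp
  fix w assume "w \<in> Lp_space M p"
  then obtain h where h: "p_integrable M p h" "w = ae_class M h" by (auto simp: Lp_space_iff)
  have mh: "h \<in> borel_measurable M" using h by (auto simp: p_integrable_def)
  show "Lp_dist M p u w \<le> Lp_dist M p u v + Lp_dist M p v w"
    unfolding f(2) g(2) h(2) Lp_dist_class[OF m] Lp_dist_class[OF m(1) mh] Lp_dist_class[OF m(2) mh]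
    using lp_norm_triangle[OF p p_integrable_diff[OF p f(1) g(1)] p_integrable_diff[OF p g(1) h(1)]]
    by simp
qed

lemma Lambda_diff:
  assumes p: "p \<ge> 1" and [measurable]: "f \<in> borel_measurable M" "g \<in> borel_measurable M"
    and "p_integrable M p (\<lambda>x. min \<bar>f x\<bar> 1)" "p_integrable M p (\<lambda>x. min \<bar>g x\<bar> 1)"
  shows "p_integrable M p (\<lambda>x. min \<bar>f x - g x\<bar> 1)"
  by (rule p_integrable_mono(1)[OF p p_integrable_add[OF p assms(4,5)]]) auto

theorem Metric_space_Lambda:
  assumes p: "p \<ge> 1"
  shows "Metric_space (Lambda_space M p) (Lambda_dist M p)"
proof
  show "0 \<le> Lambda_dist M p u v" for u v by (simp add: Lambda_dist_def lp_norm_nonneg)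
  show "Lambda_dist M p u v = Lambda_dist M p v u" for u v
    by (simp add: Lambda_dist_def abs_minus_commute)
  fix u v assume "u \<in> Lambda_space M p" "v \<in> Lambda_space M p"
  then obtain f g where m: "f \<in> borel_measurable M" "g \<in> borel_measurable M"
    and f: "p_integrable M p (\<lambda>x. min \<bar>f x\<bar> 1)" "u = ae_class M f"
    and g: "p_integrable M p (\<lambda>x. min \<bar>g x\<bar> 1)" "v = ae_class M g"
    by (auto simp: Lambda_space_iff)
  have *: "min \<bar>f x - g x\<bar> 1 = 0 \<longleftrightarrow> f x = g x" for x by auto
  show "Lambda_dist M p u v = 0 \<longleftrightarrow> u = v"
    unfolding f(2) g(2) Lambda_dist_class[OF m] ae_class_eq_iff[OF m]
    by (subst lp_norm_eq_0_iff[OF p Lambda_diff[OF p m f(1) g(1)]]) (simp only: *)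
  fix w assume "w \<in> Lambda_space M p"
  then obtain h where mh[measurable]: "h \<in> borel_measurable M"
    and h: "p_integrable M p (\<lambda>x. min \<bar>h x\<bar> 1)" "w = ae_class M h"
    by (auto simp: Lambda_space_iff)
  note [measurable] = m
  note fg = Lambda_diff[OF p m f(1) g(1)] and gh = Lambda_diff[OF p m(2) mh g(1) h(1)]
  have "lp_norm M p (\<lambda>x. min \<bar>f x - h x\<bar> 1) \<le>
      lp_norm M p (\<lambda>x. min \<bar>f x - g x\<bar> 1 + min \<bar>g x - h x\<bar> 1)"
    by (rule p_integrable_mono(2)[OF p p_integrable_add[OF p fg gh]]) auto
  also have "\<dots> \<le> lp_norm M p (\<lambda>x. min \<bar>f x - g x\<bar> 1) + lp_norm M p (\<lambda>x. min \<bar>g x - h x\<bar> 1)"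
    by (rule lp_norm_triangle[OF p fg gh])
  finally show "Lambda_dist M p u w \<le> Lambda_dist M p u v + Lambda_dist M p v w"
    unfolding f(2) g(2) h(2)
      Lambda_dist_class[OF m] Lambda_dist_class[OF m(1) mh] Lambda_dist_class[OF m(2) mh] .
qed

lemma trunc_class_in_Lp_space:
  assumes p: "p \<ge> 1" and c: "c > 0" and "u \<in> Lambda_space M p"
  shows "trunc_class M c u \<in> Lp_space M p"
proof -
  obtain f where f [measurable]: "f \<in> borel_measurable M"
    and i: "p_integrable M p (\<lambda>x. min \<bar>f x\<bar> 1)" and u: "u = ae_class M f"
    using assms(3) by (auto simp: Lambda_space_iff)
  have k: "p_integrable M p (\<lambda>x. max c 1 * min \<bar>f x\<bar> 1)"
    using i c by (auto simp: p_integrable_def abs_mult powr_mult)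
  have "p_integrable M p (trunc c \<circ> f)"
  proof (rule p_integrable_mono(1)[OF p k])
    fix x
    show "\<bar>(trunc c \<circ> f) x\<bar> \<le> \<bar>max c 1 * min \<bar>f x\<bar> 1\<bar>"
    proof (cases "\<bar>f x\<bar> \<le> 1")
      case True
      have "\<bar>(trunc c \<circ> f) x\<bar> \<le> 1 * \<bar>f x\<bar>" using c by (auto simp: trunc_def)
      also have "\<dots> \<le> max c 1 * \<bar>f x\<bar>" by (intro mult_right_mono) auto
      finally show ?thesis using True c by (simp add: abs_mult min_def)
    next
      case False
      then show ?thesis using c by (auto simp: trunc_def min_def)
    qed
  qed measurable
  then show ?thesis unfolding u trunc_class_class[OF f] by (auto simp: Lp_space_iff)
qed

end

theory Submission
  imports Defs
begin

text \<open>
  The map \<open>u \<mapsto> T\<^sub>c u\<close> is \<open>max 1 (2 c)\<close>-Lipschitz from \<open>\<Lambda>\<^sup>p\<close> to \<open>L\<^sup>p\<close>, which gives (i), and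
  \<open>1\<close>-Lipschitz from \<open>\<Lambda>\<^sup>p\<close> to itself. By dominated convergence \<open>T\<^sub>c u \<rightarrow> u\<close> in \<open>\<Lambda>\<^sup>p\<close> for a
  single \<open>u\<close>; the convergence is uniform on a finite net, hence up to \<open>2\<epsilon>\<close> on the whole family,
  which gives (ii). Conversely, (ii) moves the family to \<open>T\<^sub>c F\<close> for one large \<open>c\<close>, and an
  \<open>L\<^sup>p\<close>-net of \<open>T\<^sub>c F\<close> lifts to a net of \<open>F\<close> because \<open>\<Lambda>\<^sup>p\<close>-distances are at most
  \<open>L\<^sup>p\<close>-distances.
\<close>

lemma lp_norm_cmult:
  assumes "p \<ge> 1"
  shows "lp_norm M p (\<lambda>x. k * f x) = \<bar>k\<bar> * lp_norm M p f"
  using assms by (simp add: lp_norm_def abs_mult powr_mult powr_powr)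

lemma p_integrable_cmult: "p_integrable M p f \<Longrightarrow> p_integrable M p (\<lambda>x. k * f x)"
  by (auto simp: p_integrable_def abs_mult powr_mult)

lemma Lambda_spaceE:
  assumes "u \<in> Lambda_space M p"
  obtains f where "f \<in> borel_measurable M" "p_integrable M p (\<lambda>x. min \<bar>f x\<bar> 1)" "u = ae_class M f"
  using assms by (auto simp: Lambda_space_iff)

text \<open>Since \<open>min \<bar>f x\<bar> 1\<close> \<le> \<open>\<bar>f x\<bar>\<close>. This
  makes truncations points of both metric spaces, so that the triangle inequality of
  \<open>Lambda_dist\<close> applies to them.\<close>

lemma Lp_space_subset_Lambda_space:
  assumes "p \<ge> 1"
  shows "Lp_space M p \<subseteq> Lambda_space M p"
proof
  fix u assume "u \<in> Lp_space M p"
  then obtain f where f: "p_integrable M p f" "u = ae_class M f" by (auto simp: Lp_space_iff)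
  then have [measurable]: "f \<in> borel_measurable M" by (simp add: p_integrable_def)
  have "p_integrable M p (\<lambda>x. min \<bar>f x\<bar> 1)"
    by (rule p_integrable_mono(1)[OF assms f(1)]) auto
  then show "u \<in> Lambda_space M p" using f(2) by (auto simp: Lambda_space_iff)
qed

lemma Lambda_dist_le_Lp_dist:
  assumes p: "p \<ge> 1" and "u \<in> Lp_space M p" "v \<in> Lp_space M p"
  shows "Lambda_dist M p u v \<le> Lp_dist M p u v"
proof -
  obtain f g where f: "p_integrable M p f" "u = ae_class M f"
    and g: "p_integrable M p g" "v = ae_class M g"
    using assms by (auto simp: Lp_space_iff)
  then have m [measurable]: "f \<in> borel_measurable M" "g \<in> borel_measurable M"
    by (auto simp: p_integrable_def)
  show ?thesis
    unfolding f(2) g(2) Lambda_dist_class[OF m] Lp_dist_class[OF m]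
    by (rule p_integrable_mono(2)[OF p p_integrable_diff[OF p f(1) g(1)]]) auto
qed

lemma Lp_dist_trunc_class_le:
  assumes p: "p \<ge> 1" and c: "c > 0" and "u \<in> Lambda_space M p" "v \<in> Lambda_space M p"
  shows "Lp_dist M p (trunc_class M c u) (trunc_class M c v) \<le> max 1 (2 * c) * Lambda_dist M p u v"
proof -
  obtain f where f [measurable]: "f \<in> borel_measurable M"
    and fi: "p_integrable M p (\<lambda>x. min \<bar>f x\<bar> 1)" and u: "u = ae_class M f"
    using assms(3) by (rule Lambda_spaceE)
  obtain g where g [measurable]: "g \<in> borel_measurable M"
    and gi: "p_integrable M p (\<lambda>x. min \<bar>g x\<bar> 1)" and v: "v = ae_class M g"
    using assms(4) by (rule Lambda_spaceE)
  let ?K = "max 1 (2 * c)"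
  \<comment> \<open>For close arguments the truncation contracts, which accounts for the 1 in the
    maximum. For arguments more than 1 apart the right side is the constant itself, and 2c is the
    length of the interval [-c, c] containing both values.\<close>
  have *: "\<bar>trunc c a - trunc c b\<bar> \<le> ?K * min \<bar>a - b\<bar> 1" for a b
  proof (cases "\<bar>a - b\<bar> \<le> 1")
    case True
    have "\<bar>trunc c a - trunc c b\<bar> \<le> 1 * \<bar>a - b\<bar>" using c by (auto simp: trunc_def)
    also have "\<dots> \<le> ?K * \<bar>a - b\<bar>" by (intro mult_right_mono) auto
    finally show ?thesis using True by simp
  next
    case False
    then show ?thesis using c by (auto simp: trunc_def)
  qed
  have "lp_norm M p (\<lambda>x. (trunc c \<circ> f) x - (trunc c \<circ> g) x) \<le>
      lp_norm M p (\<lambda>x. ?K * min \<bar>f x - g x\<bar> 1)"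
  proof (rule p_integrable_mono(2)[OF p p_integrable_cmult[OF Lambda_diff[OF p f g fi gi]]])
    show "\<bar>(trunc c \<circ> f) x - (trunc c \<circ> g) x\<bar> \<le> \<bar>?K * min \<bar>f x - g x\<bar> 1\<bar>" for x
      using *[of "f x" "g x"] by simp
  qed measurable
  then show ?thesis
    unfolding u v trunc_class_class[OF f] trunc_class_class[OF g] lp_norm_cmult[OF p]
    by (simp add: Lp_dist_class Lambda_dist_class)
qed

text \<open>Contraction survives the cap at 1, so the constant does not grow with c. Combining the
  two preceding bounds would only give \<open>max 1 (2 * c)\<close>, useless for a limit as c tends
  to infinity.\<close>

lemma Lambda_dist_trunc_class_le:
  assumes p: "p \<ge> 1" and c: "c > 0" and "u \<in> Lambda_space M p" "v \<in> Lambda_space M p"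
  shows "Lambda_dist M p (trunc_class M c u) (trunc_class M c v) \<le> Lambda_dist M p u v"
proof -
  obtain f where f [measurable]: "f \<in> borel_measurable M"
    and fi: "p_integrable M p (\<lambda>x. min \<bar>f x\<bar> 1)" and u: "u = ae_class M f"
    using assms(3) by (rule Lambda_spaceE)
  obtain g where g [measurable]: "g \<in> borel_measurable M"
    and gi: "p_integrable M p (\<lambda>x. min \<bar>g x\<bar> 1)" and v: "v = ae_class M g"
    using assms(4) by (rule Lambda_spaceE)
  have *: "\<bar>trunc c a - trunc c b\<bar> \<le> \<bar>a - b\<bar>" for a b
    using c by (auto simp: trunc_def max_def min_def)
  have "lp_norm M p (\<lambda>x. min \<bar>(trunc c \<circ> f) x - (trunc c \<circ> g) x\<bar> 1) \<le>
      lp_norm M p (\<lambda>x. min \<bar>f x - g x\<bar> 1)"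
  proof (rule p_integrable_mono(2)[OF p Lambda_diff[OF p f g fi gi]])
    show "\<bar>min \<bar>(trunc c \<circ> f) x - (trunc c \<circ> g) x\<bar> 1\<bar> \<le> \<bar>min \<bar>f x - g x\<bar> 1\<bar>" for x
      using *[of "f x" "g x"] by simp
  qed measurable
  then show ?thesis
    unfolding u v trunc_class_class[OF f] trunc_class_class[OF g]
    by (simp add: Lambda_dist_class)
qed

lemma tendsto_Lambda_dist_trunc_class:
  assumes p: "p \<ge> 1" and "u \<in> Lambda_space M p"
  shows "((\<lambda>c. Lambda_dist M p u (trunc_class M c u)) \<longlongrightarrow> 0) at_top"
proof -
  obtain f where f [measurable]: "f \<in> borel_measurable M"
    and fi: "p_integrable M p (\<lambda>x. min \<bar>f x\<bar> 1)" and u: "u = ae_class M f"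
    using assms(2) by (rule Lambda_spaceE)
  define s where "s c x = \<bar>min \<bar>f x - trunc c (f x)\<bar> 1\<bar> powr p" for c x
  have "((\<lambda>c. \<integral>x. s c x \<partial>M) \<longlongrightarrow> (\<integral>x. 0 \<partial>M)) at_top"
  proof (rule integral_dominated_convergence_at_top)
    show "integrable M (\<lambda>x. \<bar>min \<bar>f x\<bar> 1\<bar> powr p)" using fi by (simp add: p_integrable_def)
    \<comment> \<open>For c \<ge> 0, cutting off does not overshoot:
      \<open>\<bar>f x - trunc c (f x)\<bar>\<close> \<le> \<open>\<bar>f x\<bar>\<close>.\<close>
    show "\<forall>\<^sub>F c in at_top. AE x in M. norm (s c x) \<le> \<bar>min \<bar>f x\<bar> 1\<bar> powr p"
      using eventually_ge_at_top[of 0]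
    proof eventually_elim
      case (elim c)
      have "norm (s c x) \<le> \<bar>min \<bar>f x\<bar> 1\<bar> powr p" for x
        using p elim by (auto simp: s_def trunc_def intro!: powr_mono2)
      then show ?case by simp
    qed
    show "AE x in M. ((\<lambda>c. s c x) \<longlongrightarrow> 0) at_top"
    proof (rule AE_I2)
      fix x
      \<comment> \<open>Once c reaches \<open>\<bar>f x\<bar>\<close>, truncation fixes
        \<open>f x\<close>.\<close>
      have "\<forall>\<^sub>F c in at_top. s c x = 0"
        using eventually_ge_at_top[of "\<bar>f x\<bar>"] by eventually_elim (auto simp: s_def trunc_def)
      then show "((\<lambda>c. s c x) \<longlongrightarrow> 0) at_top" by (rule tendsto_eventually)
    qed
  qed (auto simp: s_def)
  \<comment> \<open>The base tends to 0; \<open>powr\<close> is continuous there because the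
    integrals are nonnegative and the exponent \<open>1 / p\<close> is positive.\<close>
  then have "((\<lambda>c. (\<integral>x. s c x \<partial>M) powr (1 / p)) \<longlongrightarrow> 0 powr (1 / p)) at_top"
    using p by (intro tendsto_powr') (auto simp: s_def)
  then show ?thesis
    unfolding u trunc_class_class[OF f] using p
    by (simp add: Lambda_dist_class lp_norm_def s_def)
qed

text \<open>The supremum is formed in \<open>ennreal\<close>, so it is meaningful without a prior
  bound on the distances and equals 0 for empty \<open>F\<close>.\<close>

theorem theorem3p1:
  fixes M :: "'a measure" and p :: real and F :: "('a \<Rightarrow> real) set set"
  assumes "1 \<le> p" and "F \<subseteq> Lambda_space M p"
  shows "Metric_space.mtotally_bounded (Lambda_space M p) (Lambda_dist M p) F \<longleftrightarrow>
    (\<forall>c>0. Metric_space.mtotally_bounded (Lp_space M p) (Lp_dist M p) (trunc_class M c ` F)) \<and>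
    ((\<lambda>c. SUP u\<in>F. ennreal (Lambda_dist M p u (trunc_class M c u))) \<longlongrightarrow> 0) at_top"
    (is "?L \<longleftrightarrow> ?R1 \<and> ?R2")
proof -
  note p = assms(1)
  interpret \<Lambda>: Metric_space "Lambda_space M p" "Lambda_dist M p"
    by (rule Metric_space_Lambda[OF p])
  interpret L: Metric_space "Lp_space M p" "Lp_dist M p"
    by (rule Metric_space_Lp[OF p])
  let ?T = "trunc_class M"
  let ?d = "Lambda_dist M p"
  have F: "u \<in> Lambda_space M p" if "u \<in> F" for u
    using that assms(2) by blast
  have TL: "?T c u \<in> Lp_space M p" if "u \<in> F" "c > 0" for c u
    using trunc_class_in_Lp_space[OF p that(2) F[OF that(1)]] .
  have TLam: "?T c u \<in> Lambda_space M p" if "u \<in> F" "c > 0" for c u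
    using TL[OF that] Lp_space_subset_Lambda_space[OF p] by blast
  show ?thesis
  proof
    assume ?L
    then have net: "\<exists>K. finite K \<and> K \<subseteq> F \<and> F \<subseteq> (\<Union>v\<in>K. \<Lambda>.mball v e)" if "e > 0" for e
      using that by (simp add: \<Lambda>.mtotally_bounded_def)
    have ?R1
    proof (intro allI impI)
      fix c :: real assume c: "c > 0"
      show "L.mtotally_bounded (?T c ` F)"
        unfolding L.mtotally_bounded_def
      proof (intro allI impI)
        fix e :: real assume e: "e > 0"
        let ?e = "e / max 1 (2 * c)"
        have "?e > 0" using e by simp
        then obtain K where K: "finite K" "K \<subseteq> F" "F \<subseteq> (\<Union>v\<in>K. \<Lambda>.mball v ?e)"
          using net by meson
        have "?T c ` F \<subseteq> (\<Union>w\<in>?T c ` K. L.mball w e)"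
        proof clarify
          fix u assume u: "u \<in> F"
          then obtain v where v: "v \<in> K" "?d v u < ?e" using K(3) by auto
          then have vF: "v \<in> F" using K(2) by blast
          have "Lp_dist M p (?T c v) (?T c u) \<le> max 1 (2 * c) * ?d v u"
            by (rule Lp_dist_trunc_class_le[OF p c F[OF vF] F[OF u]])
          also have "\<dots> < e" using v(2) by (simp add: pos_less_divide_eq mult.commute)
          finally show "?T c u \<in> (\<Union>w\<in>?T c ` K. L.mball w e)"
            using v(1) TL[OF vF c] TL[OF u c] by auto
        qed
        then show "\<exists>K. finite K \<and> K \<subseteq> ?T c ` F \<and> ?T c ` F \<subseteq> (\<Union>w\<in>K. L.mball w e)"
          using K(1,2) by (intro exI[of _ "?T c ` K"]) auto
      qed
    qed
    moreover have ?R2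
    proof (rule order_tendstoI)
      fix a :: ennreal assume "0 < a"
      \<comment> \<open>The factor 3 counts the legs u to v, v to T_c v, T_c v to T_c u. The
        inequality is strict because the supremum is later bounded only by \<le>
        \<open>3 * e\<close>; hence r / 4 rather than r / 3.\<close>
      then obtain e :: real where e: "e > 0" "ennreal (3 * e) < a"
      proof (cases a)
        case (real r)
        with \<open>0 < a\<close> have "r > 0" by simp
        then show ?thesis using real by (intro that[of "r / 4"]) (auto simp: ennreal_less_iff)
      next
        case top
        then show ?thesis by (intro that[of 1]) auto
      qed
      obtain K where K: "finite K" "K \<subseteq> F" "F \<subseteq> (\<Union>v\<in>K. \<Lambda>.mball v e)"
        using net[OF e(1)] by blast
      have "\<forall>\<^sub>F c in at_top. ?d v (?T c v) < e" if "v \<in> K" for v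
        using tendsto_Lambda_dist_trunc_class[OF p F] K(2) that e(1)
        by (intro order_tendstoD(2)) auto
      \<comment> \<open>Finiteness of the net turns pointwise convergence into one threshold for all
        centres.\<close>
      then have "\<forall>\<^sub>F c in at_top. \<forall>v\<in>K. ?d v (?T c v) < e"
        using K(1) by (simp add: eventually_ball_finite)
      then show "\<forall>\<^sub>F c in at_top. (SUP u\<in>F. ennreal (?d u (?T c u))) < a"
        using eventually_gt_at_top[of 0]
      proof eventually_elim
        case (elim c)
        have "?d u (?T c u) \<le> 3 * e" if u: "u \<in> F" for u
        proof -
          obtain v where v: "v \<in> K" "?d v u < e" using u K(3) by auto
          then have vF: "v \<in> F" using K(2) by blast
          show ?thesis
            using \<Lambda>.triangle[OF F[OF u] F[OF vF] TLam[OF u elim(2)]]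
              \<Lambda>.triangle[OF F[OF vF] TLam[OF vF elim(2)] TLam[OF u elim(2)]]
              Lambda_dist_trunc_class_le[OF p elim(2) F[OF vF] F[OF u]]
              \<Lambda>.commute[of u v] v elim(1) by fastforce
        qed
        then have "(SUP u\<in>F. ennreal (?d u (?T c u))) \<le> ennreal (3 * e)"
          by (intro SUP_least ennreal_leI)
        then show ?case using e(2) by (rule le_less_trans)
      qed
    qed simp
    ultimately show "?R1 \<and> ?R2" ..
  next
    assume R: "?R1 \<and> ?R2"
    show ?L
      unfolding \<Lambda>.mtotally_bounded_def
    proof (intro allI impI)
      fix e :: real assume e: "e > 0"
      have "\<forall>\<^sub>F c in at_top. (SUP u\<in>F. ennreal (?d u (?T c u))) < ennreal (e / 3)"
        using R e by (intro order_tendstoD(2)[where y = 0]) auto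
      \<comment> \<open>Positivity is added because (i) and the membership of truncations in
        \<open>Lp_space\<close> hold for positive levels.\<close>
      then have "\<forall>\<^sub>F c in at_top. (SUP u\<in>F. ennreal (?d u (?T c u))) < ennreal (e / 3) \<and> c > 0"
        using eventually_gt_at_top[of 0] by (rule eventually_conj)
      then obtain c where c: "c > 0" and sup: "(SUP u\<in>F. ennreal (?d u (?T c u))) < ennreal (e / 3)"
        using eventually_happens'[OF trivial_limit_at_top_linorder] by blast
      have near: "?d u (?T c u) < e / 3" if "u \<in> F" for u
      proof -
        have "ennreal (?d u (?T c u)) < ennreal (e / 3)"
          using SUP_upper[OF that] sup by (rule le_less_trans)
        then show ?thesis using e by (simp add: ennreal_less_iff)
      qed
      have "L.mtotally_bounded (?T c ` F)" using R c by blast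
      then obtain K where K: "finite K" "K \<subseteq> ?T c ` F" "?T c ` F \<subseteq> (\<Union>w\<in>K. L.mball w (e / 3))"
        using e unfolding L.mtotally_bounded_def by (metis divide_pos_pos zero_less_numeral)
      \<comment> \<open>The centres of the net lie in the truncated family, so each has a preimage
        in \<open>F\<close>; finitely many chosen preimages become the centres for
        \<open>F\<close>.\<close>
      obtain G where G: "G \<subseteq> F" "finite G" "K = ?T c ` G"
        using finite_subset_image[OF K(1,2)] by blast
      have "F \<subseteq> (\<Union>v\<in>G. \<Lambda>.mball v e)"
      proof
        fix u assume u: "u \<in> F"
        then have "?T c u \<in> (\<Union>w\<in>K. L.mball w (e / 3))" using K(3) by blast
        then obtain v where v: "v \<in> G" "Lp_dist M p (?T c v) (?T c u) < e / 3" using G(3) by auto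
        then have vF: "v \<in> F" using G(1) by blast
        have "?d (?T c v) (?T c u) < e / 3"
          using Lambda_dist_le_Lp_dist[OF p TL[OF vF c] TL[OF u c]] v(2) by linarith
        \<comment> \<open>Three legs of length below e / 3: v to T_c v, T_c v to T_c u, T_c u to
          u.\<close>
        then have "?d v u < e"
          using \<Lambda>.triangle[OF F[OF vF] TLam[OF vF c] F[OF u]]
            \<Lambda>.triangle[OF TLam[OF vF c] TLam[OF u c] F[OF u]] near[OF vF] near[OF u]
            \<Lambda>.commute[of u "?T c u"] by linarith
        then show "u \<in> (\<Union>v\<in>G. \<Lambda>.mball v e)" using v(1) F[OF u] F[OF vF] by auto
      qed
      then show "\<exists>K. finite K \<and> K \<subseteq> F \<and> F \<subseteq> (\<Union>v\<in>K. \<Lambda>.mball v e)" using G by blast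
    qed
  qed
qed

end
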